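(* Let $H\le G$ be a closed embedding of topological groups such that the translation action of $H$ on $G$ is principal. Let $H$ act freely and continuously on a space $Y$. If the induced action of $G$ on $X:=G\times_H Y$ is principal, then the action of $H$ on $Y$ is principal. In particular, if in addition $G$ is compact, then: - if every free continuous $G$-action on a Tychonoff space is principal, then every free continuous $H$-action on a Tychonoff space is principal; - if every free continuous $G$-action on a compact Hausdorff space is principal, then every free continuous $H$-action on a compact Hausdorff space is principal.
   Context: Topological groups and the spaces acted upon are assumed Tychonoff (completely regular Hausdorff). A free continuous action of a topological group $K$ on a space $Z$ is principal if $Z\to Z/K$ is a locally trivial principal $K$-bundle; equivalently, every $K$-orbit in $Z$ has an open $K$-invariant neighborhood admitting a continuous $K$-equivariant map to $K$ (with its left translation action). The twisted product $G\times_H Y$ is the quotient of $G\times Y$ by the equivalence relation $(gh,y)\sim(g,hy)$ for $g\in G$, $h\in H$, $y\in Y$, with $G$ acting by left multiplication on the first factor. *)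

theory Defs
  imports "HOL-Analysis.Analysis" "HOL-Algebra.Group_Action"
begin

definition tychonoff_space :: "'a topology \<Rightarrow> bool"
  where "tychonoff_space X \<longleftrightarrow> completely_regular_space X \<and> Hausdorff_space X"

definition topological_group :: "('g, 'm) monoid_scheme \<Rightarrow> 'g topology \<Rightarrow> bool"
  where "topological_group G T \<longleftrightarrow>
    group G \<and> topspace T = carrier G \<and>
    continuous_map (prod_topology T T) T (\<lambda>(x, y). x \<otimes>\<^bsub>G\<^esub> y) \<and>
    continuous_map T T (\<lambda>x. inv\<^bsub>G\<^esub> x)"

definition quotient_topology :: "'a topology \<Rightarrow> ('a \<Rightarrow> 'b) \<Rightarrow> 'b topology"
  where "quotient_topology X q =
    topology (\<lambda>U. U \<subseteq> q ` topspace X \<and> openin X {x \<in> topspace X. q x \<in> U})"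

lemma openin_quotient_topology:
  "openin (quotient_topology X q) U \<longleftrightarrow>
    U \<subseteq> q ` topspace X \<and> openin X {x \<in> topspace X. q x \<in> U}"
proof -
  have "istopology (\<lambda>U. U \<subseteq> q ` topspace X \<and> openin X {x \<in> topspace X. q x \<in> U})"
    unfolding istopology_def
  proof (intro conjI allI impI)
    fix S T
    assume S: "S \<subseteq> q ` topspace X \<and> openin X {x \<in> topspace X. q x \<in> S}"
      and T: "T \<subseteq> q ` topspace X \<and> openin X {x \<in> topspace X. q x \<in> T}"
    then show "S \<inter> T \<subseteq> q ` topspace X" by blast
    have "{x \<in> topspace X. q x \<in> S \<inter> T} =
        {x \<in> topspace X. q x \<in> S} \<inter> {x \<in> topspace X. q x \<in> T}" by blast
    moreover have "openin X ({x \<in> topspace X. q x \<in> S} \<inter> {x \<in> topspace X. q x \<in> T})"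
      using S T by (intro openin_Int) auto
    ultimately show "openin X {x \<in> topspace X. q x \<in> S \<inter> T}" by (simp only:)
  next
    fix K
    assume K: "\<forall>S\<in>K. S \<subseteq> q ` topspace X \<and> openin X {x \<in> topspace X. q x \<in> S}"
    then show "\<Union>K \<subseteq> q ` topspace X" by blast
    have "{x \<in> topspace X. q x \<in> \<Union>K} = (\<Union>S\<in>K. {x \<in> topspace X. q x \<in> S})" by blast
    moreover have "openin X (\<Union>S\<in>K. {x \<in> topspace X. q x \<in> S})"
      using K by (intro openin_Union) auto
    ultimately show "openin X {x \<in> topspace X. q x \<in> \<Union>K}" by (simp only:)
  qed
  then show ?thesis unfolding quotient_topology_def by (simp only: topology_inverse')
qed

lemma quotient_map_quotient_topology: "quotient_map X (quotient_topology X q) q"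
proof -
  have "topspace (quotient_topology X q) = q ` topspace X"
  proof
    show "topspace (quotient_topology X q) \<subseteq> q ` topspace X"
      using openin_quotient_topology[of X q "topspace (quotient_topology X q)"] by simp
    have "{x \<in> topspace X. q x \<in> q ` topspace X} = topspace X" by blast
    then have "openin (quotient_topology X q) (q ` topspace X)"
      by (simp add: openin_quotient_topology)
    then show "q ` topspace X \<subseteq> topspace (quotient_topology X q)"
      by (rule openin_subset)
  qed
  then show ?thesis
    unfolding quotient_map_def openin_quotient_topology by simp
qed

definition free_continuous_action ::
    "('k, 'm) monoid_scheme \<Rightarrow> 'k topology \<Rightarrow> 'z topology \<Rightarrow> ('k \<Rightarrow> 'z \<Rightarrow> 'z) \<Rightarrow> bool"
  where "free_continuous_action K TK Z \<phi> \<longleftrightarrow>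
    group_action K (topspace Z) \<phi> \<and>
    continuous_map (prod_topology TK Z) Z (\<lambda>(k, z). \<phi> k z) \<and>
    (\<forall>z \<in> topspace Z. stabilizer K \<phi> z = {\<one>\<^bsub>K\<^esub>})"

definition orbit_space ::
    "('k, 'm) monoid_scheme \<Rightarrow> 'z topology \<Rightarrow> ('k \<Rightarrow> 'z \<Rightarrow> 'z) \<Rightarrow> 'z set topology"
  where "orbit_space K Z \<phi> = quotient_topology Z (orbit K \<phi>)"

text \<open>Local triviality: over a neighbourhood \<open>U\<close> of each point of \<open>Z/K\<close>, the part of \<open>Z\<close> above
  \<open>U\<close> is homeomorphic to \<open>U \<times> K\<close>, compatibly with the projections to \<open>U\<close> and equivariantly for
  left translation on the factor \<open>K\<close>.\<close>

definition principal_action ::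
    "('k, 'm) monoid_scheme \<Rightarrow> 'k topology \<Rightarrow> 'z topology \<Rightarrow> ('k \<Rightarrow> 'z \<Rightarrow> 'z) \<Rightarrow> bool"
  where "principal_action K TK Z \<phi> \<longleftrightarrow>
    free_continuous_action K TK Z \<phi> \<and>
    (\<forall>b \<in> topspace (orbit_space K Z \<phi>). \<exists>U t.
      openin (orbit_space K Z \<phi>) U \<and> b \<in> U \<and>
      homeomorphic_map
        (subtopology Z {z \<in> topspace Z. orbit K \<phi> z \<in> U})
        (prod_topology (subtopology (orbit_space K Z \<phi>) U) TK) t \<and>
      (\<forall>z \<in> topspace Z. orbit K \<phi> z \<in> U \<longrightarrow>
        fst (t z) = orbit K \<phi> z \<and>
        (\<forall>k \<in> carrier K. snd (t (\<phi> k z)) = k \<otimes>\<^bsub>K\<^esub> snd (t z))))"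

text \<open>Right translation of a subgroup \<open>H\<close> on \<open>G\<close>, written as a left action; its orbits are the
  cosets \<open>gH\<close>. Inversion of \<open>G\<close> identifies it with left translation.\<close>

definition translation_action :: "('g, 'm) monoid_scheme \<Rightarrow> 'g \<Rightarrow> 'g \<Rightarrow> 'g"
  where "translation_action G = (\<lambda>h. \<lambda>g \<in> carrier G. g \<otimes>\<^bsub>G\<^esub> inv\<^bsub>G\<^esub> h)"

text \<open>For a subgroup \<open>H\<close> acting on \<open>E\<close> this set of pairs is already an equivalence relation on
  \<open>carrier G \<times> E\<close>; no closure has to be taken.\<close>

definition twisted_rel ::
    "('g, 'm) monoid_scheme \<Rightarrow> 'g set \<Rightarrow> 'y set \<Rightarrow> ('g \<Rightarrow> 'y \<Rightarrow> 'y) \<Rightarrow> ('g \<times> 'y) rel"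
  where "twisted_rel G H E \<psi> =
    {((g \<otimes>\<^bsub>G\<^esub> h, y), (g, \<psi> h y)) | g h y. g \<in> carrier G \<and> h \<in> H \<and> y \<in> E}"

definition twisted_product ::
    "('g, 'm) monoid_scheme \<Rightarrow> 'g topology \<Rightarrow> 'g set \<Rightarrow> 'y topology \<Rightarrow> ('g \<Rightarrow> 'y \<Rightarrow> 'y)
      \<Rightarrow> ('g \<times> 'y) set topology"
  where "twisted_product G TG H Y \<psi> =
    quotient_topology (prod_topology TG Y) (\<lambda>p. twisted_rel G H (topspace Y) \<psi> `` {p})"

text \<open>The image of the class of \<open>(a, y)\<close> under left multiplication of the first coordinate by \<open>g\<close>
  is exactly the class of \<open>(ga, y)\<close>.\<close>

definition twisted_action ::
    "('g, 'm) monoid_scheme \<Rightarrow> 'g topology \<Rightarrow> 'g set \<Rightarrow> 'y topology \<Rightarrow> ('g \<Rightarrow> 'y \<Rightarrow> 'y)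
      \<Rightarrow> 'g \<Rightarrow> ('g \<times> 'y) set \<Rightarrow> ('g \<times> 'y) set"
  where "twisted_action G TG H Y \<psi> =
    (\<lambda>g. \<lambda>C \<in> topspace (twisted_product G TG H Y \<psi>). (\<lambda>(a, y). (g \<otimes>\<^bsub>G\<^esub> a, y)) ` C)"

text \<open>The following two properties range over the spaces carried by one fixed type \<open>'z\<close>, since
  types cannot be quantified over.\<close>

definition all_tychonoff_actions_principal ::
    "'z itself \<Rightarrow> ('k, 'm) monoid_scheme \<Rightarrow> 'k topology \<Rightarrow> bool"
  where "all_tychonoff_actions_principal (_ :: 'z itself) K TK \<longleftrightarrow>
    (\<forall>(Z :: 'z topology) \<phi>. tychonoff_space Z \<and> free_continuous_action K TK Z \<phi> \<longrightarrow>
      principal_action K TK Z \<phi>)"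

definition all_compact_actions_principal ::
    "'z itself \<Rightarrow> ('k, 'm) monoid_scheme \<Rightarrow> 'k topology \<Rightarrow> bool"
  where "all_compact_actions_principal (_ :: 'z itself) K TK \<longleftrightarrow>
    (\<forall>(Z :: 'z topology) \<phi>. compact_space Z \<and> Hausdorff_space Z \<and>
      free_continuous_action K TK Z \<phi> \<longrightarrow> principal_action K TK Z \<phi>)"

end

theory Submission
  imports Defs
begin

text \<open>A chart of a \<open>K\<close>-space is an open invariant set with a continuous equivariant map to \<open>K\<close>.
  If \<open>F\<close> is a chart of \<open>X = G \<times>\<^sub>H Y\<close> near \<open>[1, y]\<close>, then \<open>y \<mapsto> F [1, y]\<close> satisfies
  \<open>F [1, h y] = F [h, y] = h F [1, y]\<close>, so \<open>y \<mapsto> (F [1, y])\<^sup>-\<^sup>1\<close> is equivariant for right translation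
  of \<open>H\<close> on \<open>G\<close>, and composing it with a chart of \<open>G\<close> gives a chart of \<open>Y\<close>.

  The twisted product is the orbit space of \<open>H\<close> acting on \<open>G \<times> Y\<close> by \<open>h (g, y) = (g h\<^sup>-\<^sup>1, h y)\<close>. For
  compact \<open>H\<close> its orbit map is open and closed, and such maps preserve complete regularity: push a
  function forward by its infimum over fibres. For compact \<open>G\<close> the product of \<open>G\<close> with this orbit map is
  again a quotient map, so \<open>G\<close> acts continuously on \<open>X\<close>.\<close>

section \<open>Group actions and orbit spaces\<close>

lemma group_actionI:
  assumes "group K"
    and "\<And>k. k \<in> carrier K \<Longrightarrow> \<phi> k \<in> extensional E"
    and closed: "\<And>k x. k \<in> carrier K \<Longrightarrow> x \<in> E \<Longrightarrow> \<phi> k x \<in> E"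
    and one: "\<And>x. x \<in> E \<Longrightarrow> \<phi> \<one>\<^bsub>K\<^esub> x = x"
    and mult: "\<And>k l x. k \<in> carrier K \<Longrightarrow> l \<in> carrier K \<Longrightarrow> x \<in> E
      \<Longrightarrow> \<phi> (k \<otimes>\<^bsub>K\<^esub> l) x = \<phi> k (\<phi> l x)"
  shows "group_action K E \<phi>"
proof -
  interpret group K by fact
  have inverse: "\<phi> (inv\<^bsub>K\<^esub> k) (\<phi> k x) = x" "\<phi> k (\<phi> (inv\<^bsub>K\<^esub> k) x) = x"
    if "k \<in> carrier K" "x \<in> E" for k x
    using that mult[of "inv\<^bsub>K\<^esub> k" k x] mult[of k "inv\<^bsub>K\<^esub> k" x] by (simp_all add: one)
  have "bij_betw (\<phi> k) E E" if "k \<in> carrier K" for k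
    by (rule bij_betwI[where g = "\<phi> (inv\<^bsub>K\<^esub> k)"]) (use that closed inverse in auto)
  then have bij: "\<phi> k \<in> Bij E" if "k \<in> carrier K" for k
    using that assms(2) by (simp add: Bij_def)
  have "\<phi> \<in> hom K (BijGroup E)"
  proof (rule homI)
    fix k l assume kl: "k \<in> carrier K" "l \<in> carrier K"
    have "\<phi> (k \<otimes>\<^bsub>K\<^esub> l) = compose E (\<phi> k) (\<phi> l)"
      by (rule extensionalityI[where A = E]) (use kl assms(2) mult in \<open>auto simp: compose_eq\<close>)
    then show "\<phi> (k \<otimes>\<^bsub>K\<^esub> l) = \<phi> k \<otimes>\<^bsub>BijGroup E\<^esub> \<phi> l"
      using kl bij by (simp add: BijGroup_def)
  qed (use bij in \<open>simp add: BijGroup_def\<close>)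
  then show ?thesis
    by (simp add: group_action_def group_hom_def group_hom_axioms_def group_BijGroup is_group)
qed

context group_action
begin

lemma one_act: "x \<in> E \<Longrightarrow> \<phi> \<one> x = x"
  by (metis id_eq_one restrict_apply')

lemma act_closed: "k \<in> carrier G \<Longrightarrow> x \<in> E \<Longrightarrow> \<phi> k x \<in> E"
  using element_image by blast

lemma inv_act_act: "k \<in> carrier G \<Longrightarrow> x \<in> E \<Longrightarrow> \<phi> (inv k) (\<phi> k x) = x"
  by (rule orbit_sym_aux) auto

lemma orbit_eq_iff:
  assumes "x \<in> E" "y \<in> E"
  shows "orbit G \<phi> x = orbit G \<phi> y \<longleftrightarrow> (\<exists>k\<in>carrier G. y = \<phi> k x)"
proof
  assume "orbit G \<phi> x = orbit G \<phi> y"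
  then show "\<exists>k\<in>carrier G. y = \<phi> k x"
    using orbit_refl[OF assms(2)] unfolding orbit_def by auto
next
  assume "\<exists>k\<in>carrier G. y = \<phi> k x"
  then have y: "y \<in> orbit G \<phi> x" unfolding orbit_def by auto
  then have x: "x \<in> orbit G \<phi> y" using orbit_sym assms by blast
  have sub: "orbit G \<phi> z \<subseteq> E" if "z \<in> E" for z
    using that act_closed unfolding orbit_def by auto
  show "orbit G \<phi> x = orbit G \<phi> y"
    using orbit_trans[OF assms(1,2) _ y] orbit_trans[OF assms(2,1) _ x] sub assms by blast
qed

lemma orbit_act: "k \<in> carrier G \<Longrightarrow> x \<in> E \<Longrightarrow> orbit G \<phi> (\<phi> k x) = orbit G \<phi> x"
  using orbit_eq_iff[of x "\<phi> k x"] act_closed by auto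

end

lemma completely_regular_space_open_closed_map_image:
  assumes "completely_regular_space X" and cont: "continuous_map X Y q"
    and "open_map X Y q" and "closed_map X Y q" and surj: "q ` topspace X = topspace Y"
  shows "completely_regular_space Y"
  unfolding completely_regular_space_def
proof (intro allI impI)
  fix S y assume S: "closedin Y S \<and> y \<in> topspace Y - S"
  then obtain x where x: "x \<in> topspace X" "q x = y" using surj by force
  have "closedin X {x \<in> topspace X. q x \<in> S}"
    using S cont closedin_continuous_map_preimage by blast
  moreover have "x \<in> topspace X - {x \<in> topspace X. q x \<in> S}" using x S by auto
  ultimately obtain f :: "'a \<Rightarrow> real" where f: "continuous_map X (top_of_set {0..1}) f" "f x = 0"
      "f ` {x \<in> topspace X. q x \<in> S} \<subseteq> {1}"
    using assms(1) unfolding completely_regular_space_def by blast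
  have f01: "0 \<le> f z \<and> f z \<le> 1" if "z \<in> topspace X" for z
    using f(1) that by (force simp: continuous_map_in_subtopology)
  have fc: "openin X {z \<in> topspace X. f z < a}" "closedin X {z \<in> topspace X. f z \<le> a}" for a
    using f(1) unfolding continuous_map_upper_lower_semicontinuous_lte_gen by auto
  define F where "F b = Inf (f ` {z \<in> topspace X. q z = b})" for b
  have nonempty: "{z \<in> topspace X. q z = b} \<noteq> {}" if "b \<in> topspace Y" for b
    using that surj by force
  have bdd: "bdd_below (f ` {z \<in> topspace X. q z = b})" for b
    by (rule bdd_belowI[of _ 0]) (use f01 in auto)
  have F_less: "F b < a \<longleftrightarrow> (\<exists>z\<in>topspace X. q z = b \<and> f z < a)" if "b \<in> topspace Y" for a b
    unfolding F_def using nonempty[OF that] bdd[of b] by (subst cInf_less_iff) auto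
  have F_lower: "F b \<le> f z" if "z \<in> topspace X" "q z = b" for b z
    unfolding F_def by (rule cInf_lower) (use bdd that in auto)
  have F_nonneg: "0 \<le> F b" if "b \<in> topspace Y" for b
    using F_less[OF that, of 0] f01 by (meson not_le)
  have F_le_1: "F b \<le> 1" if "b \<in> topspace Y" for b
    using nonempty[OF that] F_lower[of _ b] f01 by force
  have less: "{b \<in> topspace Y. F b < a} = q ` {z \<in> topspace X. f z < a}" for a
    using F_less surj by auto
  \<comment> \<open>The infimum need not be attained on a fibre, hence the intersection over all \<open>c > a\<close>.\<close>
  have le: "{b \<in> topspace Y. F b \<le> a} = (\<Inter>c\<in>{a<..}. q ` {z \<in> topspace X. f z \<le> c})" for a
  proof (intro equalityI subsetI INT_I)
    fix b c assume b: "b \<in> {b \<in> topspace Y. F b \<le> a}" and "c \<in> {a<..}"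
    then have "F b < c" by auto
    then obtain z where "z \<in> topspace X" "q z = b" "f z < c" using b F_less by auto
    then show "b \<in> q ` {z \<in> topspace X. f z \<le> c}" by force
  next
    fix b assume b: "b \<in> (\<Inter>c\<in>{a<..}. q ` {z \<in> topspace X. f z \<le> c})"
    have ex: "\<exists>z\<in>topspace X. q z = b \<and> f z \<le> c" if "a < c" for c
      using b that by auto
    have "F b \<le> c" if "a < c" for c
      using ex[OF that] F_lower[of _ b] by force
    then have "F b \<le> a" by (rule dense_ge)
    moreover have "b \<in> topspace Y" using ex[of "a + 1"] surj by auto
    ultimately show "b \<in> {b \<in> topspace Y. F b \<le> a}" by simp
  qed
  have "continuous_map Y (top_of_set {0..1}) F"
    unfolding continuous_map_upper_lower_semicontinuous_lte_gen
  proof (intro conjI allI ballI)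
    show "openin Y {b \<in> topspace Y. F b < a}" for a
      using less fc assms(3) unfolding open_map_def by auto
    show "closedin Y {b \<in> topspace Y. F b \<le> a}" for a
      unfolding le using fc assms(4) unfolding closed_map_def by (intro closedin_INT) (auto simp: gt_ex)
  qed (use F_nonneg F_le_1 in auto)
  moreover have "F y = 0"
    using F_lower[of x y] F_nonneg[of y] x f(2) S by auto
  moreover have "F b = 1" if "b \<in> S" for b
  proof -
    have b: "b \<in> topspace Y" using that S closedin_subset by blast
    have "f z = 1" if "z \<in> topspace X" "q z = b" for z
      using f(3) that \<open>b \<in> S\<close> by blast
    then have "F b = Inf ((\<lambda>_. 1) ` {z \<in> topspace X. q z = b})"
      unfolding F_def by (intro arg_cong[where f = Inf] image_cong) auto
    then show ?thesis using nonempty[OF b] by (simp only: image_constant_conv if_False cInf_singleton)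
  qed
  ultimately show "\<exists>f::'b \<Rightarrow> real. continuous_map Y (top_of_set {0..1}) f \<and> f y = 0 \<and> f ` S \<subseteq> {1}"
    by blast
qed

lemma quotient_map_orbit: "quotient_map Z (orbit_space K Z \<phi>) (orbit K \<phi>)"
  unfolding orbit_space_def by (rule quotient_map_quotient_topology)

lemma topspace_orbit_space: "topspace (orbit_space K Z \<phi>) = orbit K \<phi> ` topspace Z"
  using quotient_imp_surjective_map[OF quotient_map_orbit] by metis

locale continuous_action = group_action K "topspace Z" \<phi>
  for K :: "('k, 'm) monoid_scheme" (structure) and TK and Z and \<phi> :: "'k \<Rightarrow> 'z \<Rightarrow> 'z" +
  assumes topological_group: "topological_group K TK"
    and continuous_act: "continuous_map (prod_topology TK Z) Z (\<lambda>(k, z). \<phi> k z)"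
begin

lemma topspace_group: "topspace TK = carrier K"
  using topological_group by (simp add: topological_group_def)

lemma continuous_map_act:
  assumes "continuous_map X TK f" "continuous_map X Z g"
  shows "continuous_map X Z (\<lambda>x. \<phi> (f x) (g x))"
  using continuous_map_compose[OF continuous_map_pairedI[OF assms] continuous_act]
  by (simp add: o_def)

lemma openin_act_preimage:
  assumes "k \<in> carrier K" "openin Z U"
  shows "openin Z {z \<in> topspace Z. \<phi> k z \<in> U}"
  using openin_continuous_map_preimage[OF continuous_map_act[of Z "\<lambda>_. k" "\<lambda>z. z"] assms(2)] assms(1)
  by (simp add: topspace_group)

lemma open_map_orbit: "open_map Z (orbit_space K Z \<phi>) (orbit K \<phi>)"
  unfolding open_map_def
proof (intro allI impI)
  fix U assume U: "openin Z U"
  have "{z \<in> topspace Z. orbit K \<phi> z \<in> orbit K \<phi> ` U} =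
      (\<Union>k\<in>carrier K. {z \<in> topspace Z. \<phi> k z \<in> U})"
    using openin_subset[OF U] orbit_eq_iff by (auto simp: image_iff) blast+
  moreover have "openin Z (\<Union>k\<in>carrier K. {z \<in> topspace Z. \<phi> k z \<in> U})"
    using openin_act_preimage U by (intro openin_Union) auto
  ultimately show "openin (orbit_space K Z \<phi>) (orbit K \<phi> ` U)"
    using openin_subset[OF U] by (auto simp: orbit_space_def openin_quotient_topology)
qed

lemma closed_map_orbit:
  assumes "compact_space TK"
  shows "closed_map Z (orbit_space K Z \<phi>) (orbit K \<phi>)"
  unfolding closed_map_def
proof (intro allI impI)
  fix C assume C: "closedin Z C"
  have "closedin (prod_topology TK Z) {p \<in> topspace (prod_topology TK Z). (\<lambda>(k, z). \<phi> k z) p \<in> C}"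
    by (rule closedin_continuous_map_preimage[OF continuous_act C])
  then have "closedin Z (snd ` {p \<in> topspace (prod_topology TK Z). (\<lambda>(k, z). \<phi> k z) p \<in> C})"
    using closed_map_snd[OF assms] unfolding closed_map_def by blast
  moreover have "snd ` {p \<in> topspace (prod_topology TK Z). (\<lambda>(k, z). \<phi> k z) p \<in> C} =
      {z \<in> topspace Z. \<exists>k\<in>carrier K. \<phi> k z \<in> C}"
    by (force simp: topspace_group)
  moreover have "\<dots> = {z \<in> topspace Z. orbit K \<phi> z \<in> orbit K \<phi> ` C}"
    using closedin_subset[OF C] orbit_eq_iff by (auto simp: image_iff) blast+
  ultimately have "closedin Z {z \<in> topspace Z. orbit K \<phi> z \<in> orbit K \<phi> ` C}"
    by simp
  moreover have "orbit K \<phi> ` C \<subseteq> topspace (orbit_space K Z \<phi>)"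
    using closedin_subset[OF C] by (auto simp: topspace_orbit_space)
  ultimately show "closedin (orbit_space K Z \<phi>) (orbit K \<phi> ` C)"
    using quotient_map_orbit[of Z K \<phi>] unfolding quotient_map_closedin by blast
qed

lemma tychonoff_space_orbit_space:
  assumes "compact_space TK" "tychonoff_space Z"
  shows "tychonoff_space (orbit_space K Z \<phi>)"
proof -
  have cr: "completely_regular_space (orbit_space K Z \<phi>)"
    by (rule completely_regular_space_open_closed_map_image[OF _ _ open_map_orbit closed_map_orbit])
      (use assms quotient_imp_continuous_map[OF quotient_map_orbit] in
        \<open>auto simp: tychonoff_space_def topspace_orbit_space\<close>)
  have "t1_space (orbit_space K Z \<phi>)"
    by (rule t1_space_closed_map_image[OF closed_map_orbit])
      (use assms Hausdorff_imp_t1_space in \<open>auto simp: tychonoff_space_def topspace_orbit_space\<close>)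
  then show ?thesis
    using cr completely_regular_imp_regular_space regular_t1_imp_Hausdorff_space
    by (auto simp: tychonoff_space_def)
qed

end

section \<open>Local triviality through equivariant charts\<close>

text \<open>By the classical criterion an action is principal iff such pairs \<open>(V, f)\<close> exist near every point.\<close>

definition equivariant_chart ::
    "('k, 'm) monoid_scheme \<Rightarrow> 'k topology \<Rightarrow> 'z topology \<Rightarrow> ('k \<Rightarrow> 'z \<Rightarrow> 'z) \<Rightarrow> 'z set \<Rightarrow> ('z \<Rightarrow> 'k) \<Rightarrow> bool"
  where "equivariant_chart K TK Z \<phi> V f \<longleftrightarrow>
    openin Z V \<and> continuous_map (subtopology Z V) TK f \<and>
    (\<forall>k\<in>carrier K. \<forall>z\<in>V. \<phi> k z \<in> V \<and> f (\<phi> k z) = k \<otimes>\<^bsub>K\<^esub> f z)"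

lemma principal_action_imp_equivariant_chart:
  assumes "principal_action K TK Z \<phi>" and z: "z \<in> topspace Z"
  obtains V f where "equivariant_chart K TK Z \<phi> V f" "z \<in> V"
proof -
  interpret group_action K "topspace Z" \<phi>
    using assms(1) by (simp add: principal_action_def free_continuous_action_def)
  have "orbit K \<phi> z \<in> topspace (orbit_space K Z \<phi>)" using z by (simp add: topspace_orbit_space)
  then obtain U t where U: "openin (orbit_space K Z \<phi>) U" "orbit K \<phi> z \<in> U"
    and t: "homeomorphic_map (subtopology Z {z \<in> topspace Z. orbit K \<phi> z \<in> U})
        (prod_topology (subtopology (orbit_space K Z \<phi>) U) TK) t"
    and eq: "\<And>z k. z \<in> topspace Z \<Longrightarrow> orbit K \<phi> z \<in> U \<Longrightarrow> k \<in> carrier K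
      \<Longrightarrow> snd (t (\<phi> k z)) = k \<otimes>\<^bsub>K\<^esub> snd (t z)"
    using assms(1) unfolding principal_action_def by meson
  let ?V = "{z \<in> topspace Z. orbit K \<phi> z \<in> U}"
  have "openin Z ?V"
    using U by (simp add: orbit_space_def openin_quotient_topology)
  moreover have "continuous_map (subtopology Z ?V) TK (snd \<circ> t)"
    using homeomorphic_imp_continuous_map[OF t] by (simp add: continuous_map_pairwise)
  ultimately have "equivariant_chart K TK Z \<phi> ?V (snd \<circ> t)"
    unfolding equivariant_chart_def using eq act_closed orbit_act by auto
  then show thesis using that z U by auto
qed

lemma principal_actionI:
  assumes top: "topological_group K TK" and act: "free_continuous_action K TK Z \<phi>"
    and charts: "\<And>z. z \<in> topspace Z \<Longrightarrow> \<exists>V f. equivariant_chart K TK Z \<phi> V f \<and> z \<in> V"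
  shows "principal_action K TK Z \<phi>"
proof -
  interpret continuous_action K TK Z \<phi>
    using top act by (simp add: continuous_action_def continuous_action_axioms_def free_continuous_action_def)
  interpret group K using top by (simp add: topological_group_def)
  have inv_cont: "continuous_map TK TK (\<lambda>x. inv\<^bsub>K\<^esub> x)"
    using top by (simp add: topological_group_def)
  let ?O = "orbit_space K Z \<phi>" and ?q = "orbit K \<phi>"
  show ?thesis
    unfolding principal_action_def
  proof (intro conjI act ballI)
    fix b assume "b \<in> topspace ?O"
    then obtain z where z: "z \<in> topspace Z" "b = ?q z" by (auto simp: topspace_orbit_space)
    then obtain V f where V: "openin Z V" "z \<in> V" and f: "continuous_map (subtopology Z V) TK f"
      and V_act: "\<And>k x. k \<in> carrier K \<Longrightarrow> x \<in> V \<Longrightarrow> \<phi> k x \<in> V"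
      and f_act: "\<And>k x. k \<in> carrier K \<Longrightarrow> x \<in> V \<Longrightarrow> f (\<phi> k x) = k \<otimes>\<^bsub>K\<^esub> f x"
      using charts unfolding equivariant_chart_def by metis
    define U where "U = ?q ` V"
    have V_sub: "V \<subseteq> topspace Z" using V openin_subset by blast
    have U: "openin ?O U" using V open_map_orbit by (simp add: U_def open_map_def)
    have V_eq: "{x \<in> topspace Z. ?q x \<in> U} = V"
    proof (intro equalityI subsetI)
      fix x assume "x \<in> {x \<in> topspace Z. ?q x \<in> U}"
      then obtain v where "x \<in> topspace Z" "v \<in> V" "?q v = ?q x" by (auto simp: U_def)
      then show "x \<in> V" using orbit_eq_iff[of v x] V_sub V_act by auto
    qed (use V_sub in \<open>auto simp: U_def\<close>)
    have fK: "f x \<in> carrier K" if "x \<in> V" for x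
      using f that V_sub by (auto simp: continuous_map_def topspace_group)
    have quot: "quotient_map (subtopology Z V) (subtopology ?O U) ?q"
      using quotient_map_restriction[OF quotient_map_orbit V_eq] U by blast
    have V_top: "topspace (subtopology Z V) = V" using V_sub by auto
    define s where "s x = \<phi> (inv\<^bsub>K\<^esub> (f x)) x" for x
    have s_cont: "continuous_map (subtopology Z V) Z s"
      unfolding s_def using continuous_map_compose[OF f inv_cont]
      by (intro continuous_map_act) (auto simp: o_def intro: continuous_map_from_subtopology)
    have s_act: "s (\<phi> k x) = s x" if "k \<in> carrier K" "x \<in> V" for k x
    proof -
      have "s (\<phi> k x) = \<phi> (inv\<^bsub>K\<^esub> (f x)) (\<phi> (inv\<^bsub>K\<^esub> k) (\<phi> k x))"
        using that V_act f_act fK V_sub act_closed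
        by (simp add: s_def inv_mult_group composition_rule subset_iff)
      then show ?thesis using that V_sub inv_act_act by (auto simp: s_def)
    qed
    obtain \<sigma> where \<sigma>: "continuous_map (subtopology ?O U) Z \<sigma>" "\<And>x. x \<in> V \<Longrightarrow> \<sigma> (?q x) = s x"
    proof (rule quotient_map_lift_exists[OF quot s_cont])
      fix x y assume "x \<in> topspace (subtopology Z V)" "y \<in> topspace (subtopology Z V)" "?q x = ?q y"
      then show "s x = s y" using orbit_eq_iff[of x y] s_act by auto
    qed (use V_top in auto)
    have s_in: "s x \<in> V" if "x \<in> V" for x
      using that V_act fK by (simp add: s_def)
    have f_s: "f (s x) = \<one>\<^bsub>K\<^esub>" if "x \<in> V" for x
      using that f_act fK by (simp add: s_def)
    have orbit_s: "?q (s x) = ?q x" if "x \<in> V" for x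
      using that orbit_act fK V_sub by (auto simp: s_def)
    have f_act_s: "\<phi> (f x) (s x) = x" if "x \<in> V" for x
      using that V_sub fK composition_rule[of x "f x" "inv\<^bsub>K\<^esub> (f x)"] one_act by (auto simp: s_def)
    define t where "t x = (?q x, f x)" for x
    define r where "r = (\<lambda>p. \<phi> (snd p) (\<sigma> (fst p)))"
    have UV: "topspace (subtopology ?O U) = U"
      using U openin_subset by auto
    have "homeomorphic_maps (subtopology Z V) (prod_topology (subtopology ?O U) TK) t r"
      unfolding homeomorphic_maps_def
    proof (intro conjI ballI)
      show "continuous_map (subtopology Z V) (prod_topology (subtopology ?O U) TK) t"
        unfolding t_def by (intro continuous_map_pairedI quotient_imp_continuous_map[OF quot] f)
      have "continuous_map (prod_topology (subtopology ?O U) TK) Z r"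
        unfolding r_def
        by (intro continuous_map_act continuous_map_snd
            continuous_map_compose[OF continuous_map_fst \<sigma>(1), unfolded o_def])
      moreover have "r ` topspace (prod_topology (subtopology ?O U) TK) \<subseteq> V"
        using V_act s_in \<sigma>(2) UV by (auto simp: r_def topspace_group U_def)
      ultimately show "continuous_map (prod_topology (subtopology ?O U) TK) (subtopology Z V) r"
        by (auto simp: continuous_map_in_subtopology)
      show "r (t x) = x" if "x \<in> topspace (subtopology Z V)" for x
        using that V_top f_act_s \<sigma>(2) by (simp add: r_def t_def)
      show "t (r p) = p" if "p \<in> topspace (prod_topology (subtopology ?O U) TK)" for p
      proof -
        have "p \<in> U \<times> carrier K"
          using that by (simp only: topspace_prod_topology UV topspace_group)
        then obtain x k where p: "p = (?q x, k)" "x \<in> V" "k \<in> carrier K"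
          by (auto simp: U_def)
        have sx: "s x \<in> topspace Z" using s_in[OF p(2)] V_sub by blast
        have "f (\<phi> k (s x)) = k"
          using f_act[OF p(3) s_in[OF p(2)]] f_s[OF p(2)] p(3) by simp
        moreover have "?q (\<phi> k (s x)) = ?q x"
          using orbit_act[OF p(3) sx] orbit_s[OF p(2)] by simp
        ultimately show ?thesis
          using p \<sigma>(2) by (simp add: t_def r_def)
      qed
    qed
    then have hom: "homeomorphic_map (subtopology Z V) (prod_topology (subtopology ?O U) TK) t"
      by (rule homeomorphic_maps_imp_map)
    show "\<exists>U t. openin ?O U \<and> b \<in> U \<and>
        homeomorphic_map (subtopology Z {z \<in> topspace Z. ?q z \<in> U})
          (prod_topology (subtopology ?O U) TK) t \<and>
        (\<forall>z\<in>topspace Z. ?q z \<in> U \<longrightarrow> fst (t z) = ?q z \<and>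
          (\<forall>k\<in>carrier K. snd (t (\<phi> k z)) = k \<otimes>\<^bsub>K\<^esub> snd (t z)))"
    proof (intro exI conjI ballI impI)
      show "homeomorphic_map (subtopology Z {z \<in> topspace Z. ?q z \<in> U})
          (prod_topology (subtopology ?O U) TK) t"
        using hom V_eq by simp
      show "snd (t (\<phi> k x)) = k \<otimes>\<^bsub>K\<^esub> snd (t x)"
        if "x \<in> topspace Z" "?q x \<in> U" "k \<in> carrier K" for x k
        using f_act[of k x] V_eq that by (auto simp: t_def)
    qed (use U V z in \<open>auto simp: t_def U_def\<close>)
  qed
qed

lemma equivariant_chart_pullback:
  assumes chart: "equivariant_chart K TK Z \<phi> V f" and W: "openin Y W"
    and e: "continuous_map (subtopology Y W) Z e"
    and act: "\<And>k y. k \<in> carrier K \<Longrightarrow> y \<in> W \<Longrightarrow> \<psi> k y \<in> W \<and> e (\<psi> k y) = \<phi> k (e y)"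
  shows "equivariant_chart K TK Y \<psi> {y \<in> W. e y \<in> V} (f \<circ> e)"
proof -
  let ?W = "{y \<in> W. e y \<in> V}"
  have V: "openin Z V" and f: "continuous_map (subtopology Z V) TK f"
    using chart by (auto simp: equivariant_chart_def)
  have WY: "W \<subseteq> topspace Y" using W openin_subset by blast
  have "openin (subtopology Y W) {y \<in> topspace (subtopology Y W). e y \<in> V}"
    by (rule openin_continuous_map_preimage[OF e V])
  moreover have "{y \<in> topspace (subtopology Y W). e y \<in> V} = ?W" using WY by auto
  ultimately have "openin Y ?W" using W openin_trans_full by metis
  moreover have "continuous_map (subtopology Y ?W) (subtopology Z V) e"
    using continuous_map_from_subtopology_mono[OF e, of ?W]
    by (auto simp: continuous_map_in_subtopology)
  then have "continuous_map (subtopology Y ?W) TK (f \<circ> e)"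
    using f continuous_map_compose by blast
  ultimately show ?thesis
    using chart act unfolding equivariant_chart_def by auto
qed

lemma topological_group_subgroup:
  assumes G: "topological_group G TG" and H: "subgroup H G"
  shows "topological_group (G\<lparr>carrier := H\<rparr>) (subtopology TG H)"
proof -
  interpret group G using G by (simp add: topological_group_def)
  have sub: "H \<subseteq> carrier G" using H subgroup.subset by blast
  have G': "topspace TG = carrier G" "continuous_map (prod_topology TG TG) TG (\<lambda>(x, y). x \<otimes>\<^bsub>G\<^esub> y)"
      "continuous_map TG TG (\<lambda>x. inv\<^bsub>G\<^esub> x)"
    using G by (auto simp: topological_group_def)
  have mult: "continuous_map (prod_topology (subtopology TG H) (subtopology TG H)) (subtopology TG H)
      (\<lambda>(x, y). x \<otimes>\<^bsub>G\<^esub> y)"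
    using G'(2) H
    by (auto simp: continuous_map_in_subtopology prod_topology_subtopology
        intro: continuous_map_from_subtopology subgroup.m_closed)
  have "continuous_map (subtopology TG H) (subtopology TG H) (\<lambda>x. inv\<^bsub>G\<^esub> x)"
    using G'(3) H
    by (auto simp: continuous_map_in_subtopology intro: continuous_map_from_subtopology subgroup.m_inv_closed)
  then have "continuous_map (subtopology TG H) (subtopology TG H) (\<lambda>x. inv\<^bsub>G\<lparr>carrier := H\<rparr>\<^esub> x)"
    by (rule continuous_map_eq) (use H in \<open>auto simp: m_inv_consistent\<close>)
  then show ?thesis
    using mult G'(1) sub subgroup_imp_group[OF H] by (auto simp: topological_group_def)
qed


section \<open>Twisted products\<close>

locale twisted_product_action = group G + Y: group_action "G\<lparr>carrier := H\<rparr>" "topspace Y" \<psi>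
  for G :: "('g, 'm) monoid_scheme" (structure) and TG :: "'g topology"
    and H and Y :: "'y topology" and \<psi> +
  assumes group_topology: "topological_group G TG"
    and H: "subgroup H G"
    and Y_continuous: "continuous_map (prod_topology (subtopology TG H) Y) Y (\<lambda>(h, y). \<psi> h y)"
begin

abbreviation "HG \<equiv> G\<lparr>carrier := H\<rparr>"
abbreviation "TH \<equiv> subtopology TG H"
abbreviation "GY \<equiv> prod_topology TG Y"
abbreviation "X \<equiv> twisted_product G TG H Y \<psi>"
abbreviation "X_act \<equiv> twisted_action G TG H Y \<psi>"
abbreviation "cls p \<equiv> twisted_rel G H (topspace Y) \<psi> `` {p}"

definition diagonal_action :: "'g \<Rightarrow> 'g \<times> 'y \<Rightarrow> 'g \<times> 'y"
  where "diagonal_action h = (\<lambda>(g, y) \<in> carrier G \<times> topspace Y. (g \<otimes> inv h, \<psi> h y))"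

lemma topspace_G: "topspace TG = carrier G"
  using group_topology by (simp add: topological_group_def)

lemma topspace_GY: "topspace GY = carrier G \<times> topspace Y"
  by (simp add: topspace_G)

lemma mem_H: "h \<in> H \<Longrightarrow> h \<in> carrier G"
  using H subgroup.mem_carrier by metis

lemma mult_continuous:
  assumes "continuous_map Z TG f" "continuous_map Z TG g"
  shows "continuous_map Z TG (\<lambda>z. f z \<otimes> g z)"
  using continuous_map_compose[OF continuous_map_pairedI[OF assms], of TG "\<lambda>(x, y). x \<otimes> y"] group_topology
  by (simp add: o_def topological_group_def)

lemma inv_continuous: "continuous_map Z TG f \<Longrightarrow> continuous_map Z TG (\<lambda>z. inv (f z))"
  using continuous_map_compose[of Z TG f TG "\<lambda>x. inv x"] group_topology
  by (simp add: o_def topological_group_def)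

lemma psi_mult:
  "h \<in> H \<Longrightarrow> k \<in> H \<Longrightarrow> y \<in> topspace Y \<Longrightarrow> \<psi> (h \<otimes> k) y = \<psi> h (\<psi> k y)"
  using Y.composition_rule by simp

lemma psi_closed: "h \<in> H \<Longrightarrow> y \<in> topspace Y \<Longrightarrow> \<psi> h y \<in> topspace Y"
  using Y.act_closed by simp

lemma psi_one: "y \<in> topspace Y \<Longrightarrow> \<psi> \<one> y = y"
  using Y.one_act by simp

sublocale diagonal: continuous_action HG TH GY diagonal_action
proof (intro continuous_action.intro continuous_action_axioms.intro)
  show "group_action HG (topspace GY) diagonal_action"
    unfolding topspace_GY
  proof (rule group_actionI)
    show "group HG" by (rule subgroup_imp_group[OF H])
    show "diagonal_action h \<in> extensional (carrier G \<times> topspace Y)" for h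
      by (simp add: diagonal_action_def)
  next
    fix h p assume "h \<in> carrier HG" "p \<in> carrier G \<times> topspace Y"
    then show "diagonal_action h p \<in> carrier G \<times> topspace Y"
      using mem_H psi_closed by (auto simp: diagonal_action_def)
  next
    fix p assume "p \<in> carrier G \<times> topspace Y"
    then show "diagonal_action \<one>\<^bsub>HG\<^esub> p = p"
      using psi_one by (auto simp: diagonal_action_def)
  next
    fix h k p assume hk: "h \<in> carrier HG" "k \<in> carrier HG" "p \<in> carrier G \<times> topspace Y"
    then obtain g y where "p = (g, y)" "g \<in> carrier G" "y \<in> topspace Y" by auto
    then show "diagonal_action (h \<otimes>\<^bsub>HG\<^esub> k) p = diagonal_action h (diagonal_action k p)"
      using hk psi_mult psi_closed mem_H by (simp add: diagonal_action_def inv_mult_group m_assoc)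
  qed
  show "topological_group HG TH"
    by (rule topological_group_subgroup[OF group_topology H])
  have fst_TG: "continuous_map (prod_topology TH GY) TG fst"
    using continuous_map_fst[of TH GY] by (simp add: continuous_map_in_subtopology)
  have fst_snd: "continuous_map (prod_topology TH GY) TG (\<lambda>p. fst (snd p))"
    by (rule continuous_map_compose[OF continuous_map_snd continuous_map_fst, unfolded o_def])
  have snd_snd: "continuous_map (prod_topology TH GY) Y (\<lambda>p. snd (snd p))"
    by (rule continuous_map_compose[OF continuous_map_snd continuous_map_snd, unfolded o_def])
  have "continuous_map (prod_topology TH GY) Y (\<lambda>p. \<psi> (fst p) (snd (snd p)))"
    using continuous_map_compose[OF continuous_map_pairedI[OF continuous_map_fst snd_snd] Y_continuous]
    by (simp add: o_def)
  then have "continuous_map (prod_topology TH GY) GY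
      (\<lambda>p. (fst (snd p) \<otimes> inv (fst p), \<psi> (fst p) (snd (snd p))))"
    by (intro continuous_map_pairedI mult_continuous inv_continuous fst_TG fst_snd)
  then show "continuous_map (prod_topology TH GY) GY (\<lambda>(h, p). diagonal_action h p)"
    by (rule continuous_map_eq) (auto simp: diagonal_action_def topspace_G)
qed

lemma cls_eq_orbit:
  assumes "p \<in> topspace GY"
  shows "cls p = orbit HG diagonal_action p"
proof -
  obtain a y where p: "p = (a, y)" "a \<in> carrier G" "y \<in> topspace Y"
    using assms by (auto simp: topspace_G)
  have "a = g \<otimes> h \<longleftrightarrow> g = a \<otimes> inv h" if "g \<in> carrier G" "h \<in> H" for g h
    using that p mem_H[of h] by (metis inv_solve_right')
  then show ?thesis
    using p mem_H by (auto simp: twisted_rel_def orbit_def diagonal_action_def) blast+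
qed

lemma twisted_product_eq: "X = orbit_space HG GY diagonal_action"
proof -
  have "{p \<in> topspace GY. cls p \<in> U} = {p \<in> topspace GY. orbit HG diagonal_action p \<in> U}" for U
    using cls_eq_orbit by auto
  moreover have "cls ` topspace GY = orbit HG diagonal_action ` topspace GY"
    using cls_eq_orbit by (auto intro: image_cong)
  ultimately show ?thesis
    unfolding twisted_product_def orbit_space_def quotient_topology_def by (simp only:)
qed

lemma quotient_map_cls: "quotient_map GY X cls"
  unfolding twisted_product_def by (rule quotient_map_quotient_topology)

lemma topspace_twisted_product: "topspace X = cls ` topspace GY"
  using quotient_imp_surjective_map[OF quotient_map_cls] by simp

lemma cls_in: "a \<in> carrier G \<Longrightarrow> y \<in> topspace Y \<Longrightarrow> cls (a, y) \<in> topspace X"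
  by (simp add: topspace_twisted_product topspace_G)

lemma cls_cases:
  assumes "C \<in> topspace X"
  obtains a y where "a \<in> carrier G" "y \<in> topspace Y" "C = cls (a, y)"
  using assms by (auto simp: topspace_twisted_product topspace_G)

lemma cls_eq:
  assumes "a \<in> carrier G" "y \<in> topspace Y"
  shows "cls (a, y) = (\<lambda>h. (a \<otimes> inv h, \<psi> h y)) ` H"
  using assms by (subst cls_eq_orbit) (auto simp: topspace_G orbit_def diagonal_action_def)

lemma cls_eq_iff:
  assumes "a \<in> carrier G" "y \<in> topspace Y" "b \<in> carrier G" "z \<in> topspace Y"
  shows "cls (a, y) = cls (b, z) \<longleftrightarrow> (\<exists>h\<in>H. b = a \<otimes> inv h \<and> z = \<psi> h y)"
  using assms diagonal.orbit_eq_iff[of "(a, y)" "(b, z)"]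
  by (simp add: cls_eq_orbit topspace_G) (simp add: diagonal_action_def)

lemma act_cls:
  assumes "g \<in> carrier G" "a \<in> carrier G" "y \<in> topspace Y"
  shows "X_act g (cls (a, y)) = cls (g \<otimes> a, y)"
  using assms mem_H cls_in
  by (auto simp: twisted_action_def cls_eq image_image m_assoc simp del: Image_singleton_iff intro!: image_cong)

lemma group_action_twisted: "group_action G (topspace X) X_act"
proof (rule group_actionI)
  show "group G" by (rule is_group)
  show "X_act g \<in> extensional (topspace X)" for g
    by (simp add: twisted_action_def)
  show "X_act g C \<in> topspace X" if "g \<in> carrier G" "C \<in> topspace X" for g C
    using that(2) by (rule cls_cases) (use that act_cls cls_in in auto)
  show "X_act \<one> C = C" if "C \<in> topspace X" for C
    using that by (rule cls_cases) (simp add: act_cls)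
  show "X_act (g \<otimes> k) C = X_act g (X_act k C)"
    if "g \<in> carrier G" "k \<in> carrier G" "C \<in> topspace X" for g k C
    using that(3) by (rule cls_cases) (use that in \<open>simp add: act_cls m_assoc\<close>)
qed

lemma stabilizer_twisted:
  assumes free: "\<And>y. y \<in> topspace Y \<Longrightarrow> stabilizer HG \<psi> y = {\<one>}" and C: "C \<in> topspace X"
  shows "stabilizer G X_act C = {\<one>}"
proof -
  obtain a y where ay: "a \<in> carrier G" "y \<in> topspace Y" "C = cls (a, y)"
    using C by (rule cls_cases)
  have "g = \<one>" if g: "g \<in> carrier G" "cls (g \<otimes> a, y) = cls (a, y)" for g
  proof -
    obtain h where h: "h \<in> H" "g \<otimes> a \<otimes> inv h = a" "\<psi> h y = y"
      using g ay cls_eq_iff[of "g \<otimes> a" y a y] by (metis m_closed)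
    then have "h \<in> stabilizer HG \<psi> y" by (simp add: stabilizer_def)
    then have "h = \<one>" using free[OF ay(2)] by simp
    then have "g \<otimes> a = a" using h g ay by simp
    then show ?thesis using g ay by simp
  qed
  then show ?thesis
    using ay by (auto simp: stabilizer_def act_cls)
qed

lemma continuous_map_twisted_action:
  assumes "compact_space TG" "Hausdorff_space TG"
  shows "continuous_map (prod_topology TG X) X (\<lambda>(g, C). X_act g C)"
proof -
  have quot: "quotient_map (prod_topology TG GY) (prod_topology TG X) (\<lambda>(g, p). (g, cls p))"
    using assms compact_imp_locally_compact_space by (intro quotient_map_prod_right quotient_map_cls) auto
  have fst_snd: "continuous_map (prod_topology TG GY) TG (\<lambda>p. fst (snd p))"
    by (rule continuous_map_compose[OF continuous_map_snd continuous_map_fst, unfolded o_def])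
  have snd_snd: "continuous_map (prod_topology TG GY) Y (\<lambda>p. snd (snd p))"
    by (rule continuous_map_compose[OF continuous_map_snd continuous_map_snd, unfolded o_def])
  have "continuous_map (prod_topology TG GY) GY (\<lambda>p. (fst p \<otimes> fst (snd p), snd (snd p)))"
    by (intro continuous_map_pairedI mult_continuous continuous_map_fst fst_snd snd_snd)
  then have "continuous_map (prod_topology TG GY) X (\<lambda>p. cls (fst p \<otimes> fst (snd p), snd (snd p)))"
    using continuous_map_compose[OF _ quotient_imp_continuous_map[OF quotient_map_cls]]
    by (simp add: o_def)
  then have "continuous_map (prod_topology TG GY) X ((\<lambda>(g, C). X_act g C) \<circ> (\<lambda>(g, p). (g, cls p)))"
    by (rule continuous_map_eq) (auto simp: act_cls topspace_G simp del: Image_singleton_iff)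
  then show ?thesis
    using continuous_compose_quotient_map_eq[OF quot] by blast
qed

lemma equivariant_chart_from_twisted:
  assumes principal_X: "principal_action G TG X X_act"
    and principal_G: "principal_action HG TH TG (translation_action G)"
    and y: "y \<in> topspace Y"
  shows "\<exists>V f. equivariant_chart HG TH Y \<psi> V f \<and> y \<in> V"
proof -
  define i where "i y = cls (\<one>, y)" for y
  have "continuous_map Y GY (\<lambda>y. (\<one>, y))"
    by (intro continuous_map_pairedI) (auto simp: topspace_G)
  from continuous_map_compose[OF this quotient_imp_continuous_map[OF quotient_map_cls]]
  have i_cont: "continuous_map Y X i" by (simp add: o_def i_def [abs_def])
  have i_in: "i z \<in> topspace X" if "z \<in> topspace Y" for z
    using that cls_in by (simp add: i_def)
  have i_act: "i (\<psi> h z) = X_act h (i z)" if "h \<in> H" "z \<in> topspace Y" for h z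
  proof -
    have "cls (h, z) = cls (\<one>, \<psi> h z)"
      using that mem_H psi_closed by (subst cls_eq_iff) (auto intro!: bexI[of _ h])
    then show ?thesis using that mem_H by (simp add: i_def act_cls)
  qed
  obtain V F where VF: "equivariant_chart G TG X X_act V F" and "i y \<in> V"
    using principal_action_imp_equivariant_chart[OF principal_X i_in[OF y]] by blast
  then have V: "openin X V" and F: "continuous_map (subtopology X V) TG F"
    and V_act: "\<And>g C. g \<in> carrier G \<Longrightarrow> C \<in> V \<Longrightarrow> X_act g C \<in> V"
    and F_act: "\<And>g C. g \<in> carrier G \<Longrightarrow> C \<in> V \<Longrightarrow> F (X_act g C) = g \<otimes> F C"
    by (auto simp: equivariant_chart_def)
  define W where "W = {z \<in> topspace Y. i z \<in> V}"
  define e where "e z = inv (F (i z))" for z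
  have W: "openin Y W" unfolding W_def by (rule openin_continuous_map_preimage[OF i_cont V])
  have "continuous_map (subtopology Y W) (subtopology X V) i"
    using i_cont by (auto simp: W_def continuous_map_in_subtopology intro: continuous_map_from_subtopology)
  from continuous_map_compose[OF this F]
  have Fi: "continuous_map (subtopology Y W) TG (\<lambda>z. F (i z))" by (simp add: o_def)
  then have e: "continuous_map (subtopology Y W) TG e"
    unfolding e_def by (rule inv_continuous)
  have Fi_in: "F (i z) \<in> carrier G" if "z \<in> W" for z
    using Fi that by (auto simp: continuous_map_def topspace_G W_def)
  have e_in: "e z \<in> carrier G" if "z \<in> W" for z
    using Fi_in[OF that] by (simp add: e_def)
  have e_act: "\<psi> h z \<in> W \<and> e (\<psi> h z) = translation_action G h (e z)"
    if "h \<in> carrier HG" "z \<in> W" for h z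
    using that i_act[of h z] V_act F_act Fi_in[of z] mem_H psi_closed
    by (auto simp: W_def e_def translation_action_def inv_mult_group)
  obtain V' f where f: "equivariant_chart HG TH TG (translation_action G) V' f" and "e y \<in> V'"
    using principal_action_imp_equivariant_chart[OF principal_G, of "e y"] e_in[of y] y \<open>i y \<in> V\<close>
    by (auto simp: W_def topspace_G)
  then show ?thesis
    using equivariant_chart_pullback[OF f W e e_act] y \<open>i y \<in> V\<close> by (auto simp: W_def)
qed

end

theorem lemma1p5:
  fixes G :: "('g, 'm) monoid_scheme" and TG :: "'g topology" and H :: "'g set"
  assumes "topological_group G TG"
    and "tychonoff_space TG"
    and "subgroup H G"
    and "closedin TG H"
    and "principal_action (G\<lparr>carrier := H\<rparr>) (subtopology TG H) TG (translation_action G)"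
  shows "(\<forall>(Y :: 'y topology) \<psi>.
        tychonoff_space Y \<and>
        free_continuous_action (G\<lparr>carrier := H\<rparr>) (subtopology TG H) Y \<psi> \<and>
        principal_action G TG (twisted_product G TG H Y \<psi>) (twisted_action G TG H Y \<psi>)
        \<longrightarrow> principal_action (G\<lparr>carrier := H\<rparr>) (subtopology TG H) Y \<psi>)
    \<and> (compact_space TG \<longrightarrow>
        (all_tychonoff_actions_principal TYPE(('g \<times> 'y) set) G TG
          \<longrightarrow> all_tychonoff_actions_principal TYPE('y) (G\<lparr>carrier := H\<rparr>) (subtopology TG H)) \<and>
        (all_compact_actions_principal TYPE(('g \<times> 'y) set) G TG
          \<longrightarrow> all_compact_actions_principal TYPE('y) (G\<lparr>carrier := H\<rparr>) (subtopology TG H)))"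
proof -
  let ?HG = "G\<lparr>carrier := H\<rparr>" and ?TH = "subtopology TG H"
  let ?X = "twisted_product G TG H" and ?act = "twisted_action G TG H"
  have twisted: "twisted_product_action G TG H Y \<psi>"
    if "free_continuous_action ?HG ?TH Y \<psi>" for Y :: "'y topology" and \<psi>
    using that assms(1,3)
    by (simp add: twisted_product_action_def twisted_product_action_axioms_def
        free_continuous_action_def topological_group_def)
  have principal: "principal_action ?HG ?TH Y \<psi>"
    if free: "free_continuous_action ?HG ?TH Y \<psi>"
      and X: "principal_action G TG (?X Y \<psi>) (?act Y \<psi>)" for Y :: "'y topology" and \<psi>
  proof (rule principal_actionI[OF topological_group_subgroup[OF assms(1,3)] free])
    interpret twisted_product_action G TG H Y \<psi> using free by (rule twisted)
    show "\<exists>V f. equivariant_chart ?HG ?TH Y \<psi> V f \<and> y \<in> V" if "y \<in> topspace Y" for y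
      by (rule equivariant_chart_from_twisted[OF X assms(5) that])
  qed
  have X_tychonoff: "tychonoff_space (?X Y \<psi>)" and X_free: "free_continuous_action G TG (?X Y \<psi>) (?act Y \<psi>)"
    if G: "compact_space TG" and Y: "tychonoff_space Y" and free: "free_continuous_action ?HG ?TH Y \<psi>"
    for Y :: "'y topology" and \<psi>
  proof -
    interpret twisted_product_action G TG H Y \<psi> using free by (rule twisted)
    have "compact_space ?TH"
      using closedin_compact_space[OF G assms(4)] compact_space_subtopology by blast
    moreover have "tychonoff_space (prod_topology TG Y)"
      using assms(2) Y completely_regular_space_prod_topology Hausdorff_space_prod_topology
      unfolding tychonoff_space_def by blast
    ultimately show "tychonoff_space (?X Y \<psi>)"
      unfolding twisted_product_eq by (rule diagonal.tychonoff_space_orbit_space)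
    show "free_continuous_action G TG (?X Y \<psi>) (?act Y \<psi>)"
      using free assms(2) G group_action_twisted stabilizer_twisted continuous_map_twisted_action
      by (simp add: free_continuous_action_def tychonoff_space_def)
  qed
  have X_compact: "compact_space (?X Y \<psi>)" if "compact_space TG" "compact_space Y"
    for Y :: "'y topology" and \<psi> :: "'g \<Rightarrow> 'y \<Rightarrow> 'y"
  proof -
    have "compact_space (prod_topology TG Y)"
      using that by (simp add: compact_space_prod_topology)
    then show ?thesis
      unfolding twisted_product_def
      using image_compactin[OF _ quotient_imp_continuous_map] quotient_imp_surjective_map
        quotient_map_quotient_topology unfolding compact_space_def by metis
  qed
  have tychonoff: "tychonoff_space Y" if "compact_space Y" "Hausdorff_space Y" for Y :: "'y topology"
    using that compact_Hausdorff_or_regular_imp_normal_space normal_imp_completely_regular_space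
      Hausdorff_imp_t1_space by (auto simp: tychonoff_space_def)
  show ?thesis
    unfolding all_tychonoff_actions_principal_def all_compact_actions_principal_def
    using principal X_tychonoff X_free X_compact tychonoff tychonoff_space_def by metis
qed

end
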